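(* Let $N_c,N_f$ be positive integers, $G_\chi>0$, $\Lambda_{\rm EL}>0$, $M_0>0$, and put $f(p^2)=\exp(-p^2/\Lambda_{\rm EL}^2)$, $M_{\rm F}(p^2)=M_0f(p^2)$, $r=M_0/\Lambda_{\rm EL}$, and $$\alpha_\chi^{\rm F}=\frac{N_cN_fG_\chi\Lambda_{\rm EL}^2}{4\pi^2}.$$ Then the chiral gap equation of the separable scalar/pseudoscalar approximation, $$1=4N_cN_fG_\chi\int_{\mathbb{R}^4}\frac{d^4k}{(2\pi)^4}\,\frac{f^2(k^2)}{k^2+M_0^2f^2(k^2)},$$ is $$1=\alpha_\chi^{\rm F}J(r),\qquad J(r)=\int_0^\infty dx\,\frac{x e^{-2x}}{x+r^2e^{-2x}},$$ and the corresponding condensate $$\Sigma_{\rm F}=4N_c\int_{\mathbb{R}^4}\frac{d^4p}{(2\pi)^4}\,\frac{M_{\rm F}(p^2)}{p^2+M_{\rm F}^2(p^2)}$$ is $$\Sigma_{\rm F}=\frac{N_c\,r\,\Lambda_{\rm EL}^3}{4\pi^2}\,I(r),\qquad I(r)=\int_0^\infty dx\,\frac{x e^{-x}}{x+r^2e^{-2x}}.$$ Moreover, a nonzero chiral solution requires $\alpha_\chi^{\rm F}>2$: if $1=\alpha_\chi^{\rm F}J(r)$ holds for some $r>0$, then $\alpha_\chi^{\rm F}>2$.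
   Context: Momentum integrals are over Euclidean $\mathbb{R}^4$ with Lebesgue measure, and $k^2=|k|^2$ denotes the squared Euclidean norm. The separable approximation takes the scalar/pseudoscalar kernel to be $G_\chi(p,k)=G_\chi f(p^2)f(k^2)$; the gap equation and the condensate are, by definition in this approximation, the displayed momentum-space integrals. $M_0$ is the infrared dynamical mass and $\Lambda_{\rm EL}$ the effective-locality scale. *)

theory Defs
  imports "HOL-Analysis.Analysis"
begin

text \<open>
  Form factor and dynamical mass are functions of the squared Euclidean momentum
  \<open>s = p\<^sup>2\<close>.  Momentum integrals are Bochner integrals over \<open>real ^ 4\<close> with Lebesgue measure.
\<close>

definition form_factor :: "real \<Rightarrow> real \<Rightarrow> real" where
  "form_factor \<Lambda> s = exp (- s / \<Lambda>\<^sup>2)"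

definition dynamical_mass :: "real \<Rightarrow> real \<Rightarrow> real \<Rightarrow> real" where
  "dynamical_mass M0 \<Lambda> s = M0 * form_factor \<Lambda> s"

definition chiral_coupling :: "nat \<Rightarrow> nat \<Rightarrow> real \<Rightarrow> real \<Rightarrow> real" where
  "chiral_coupling Nc Nf G \<Lambda> = real Nc * real Nf * G * \<Lambda>\<^sup>2 / (4 * pi\<^sup>2)"

definition gap_integrand :: "real \<Rightarrow> real \<Rightarrow> real ^ 4 \<Rightarrow> real" where
  "gap_integrand M0 \<Lambda> k =
     1 / (2 * pi) ^ 4 *
     ((form_factor \<Lambda> ((norm k)\<^sup>2))\<^sup>2 /
      ((norm k)\<^sup>2 + M0\<^sup>2 * (form_factor \<Lambda> ((norm k)\<^sup>2))\<^sup>2))"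

definition gap_rhs :: "nat \<Rightarrow> nat \<Rightarrow> real \<Rightarrow> real \<Rightarrow> real \<Rightarrow> real" where
  "gap_rhs Nc Nf G M0 \<Lambda> =
     4 * real Nc * real Nf * G * (LINT k|lborel. gap_integrand M0 \<Lambda> k)"

definition gap_equation :: "nat \<Rightarrow> nat \<Rightarrow> real \<Rightarrow> real \<Rightarrow> real \<Rightarrow> bool" where
  "gap_equation Nc Nf G M0 \<Lambda> \<longleftrightarrow> 1 = gap_rhs Nc Nf G M0 \<Lambda>"

definition condensate_integrand :: "real \<Rightarrow> real \<Rightarrow> real ^ 4 \<Rightarrow> real" where
  "condensate_integrand M0 \<Lambda> p =
     1 / (2 * pi) ^ 4 *
     (dynamical_mass M0 \<Lambda> ((norm p)\<^sup>2) /
      ((norm p)\<^sup>2 + (dynamical_mass M0 \<Lambda> ((norm p)\<^sup>2))\<^sup>2))"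

definition condensate :: "nat \<Rightarrow> real \<Rightarrow> real \<Rightarrow> real" where
  "condensate Nc M0 \<Lambda> = 4 * real Nc * (LINT p|lborel. condensate_integrand M0 \<Lambda> p)"

definition J_integrand :: "real \<Rightarrow> real \<Rightarrow> real" where
  "J_integrand r x = x * exp (- 2 * x) / (x + r\<^sup>2 * exp (- 2 * x))"

definition J :: "real \<Rightarrow> real" where
  "J r = (LBINT x:{0..}. J_integrand r x)"

definition I_integrand :: "real \<Rightarrow> real \<Rightarrow> real" where
  "I_integrand r x = x * exp (- x) / (x + r\<^sup>2 * exp (- 2 * x))"

definition I :: "real \<Rightarrow> real" where
  "I r = (LBINT x:{0..}. I_integrand r x)"

end

theory Submission
  imports Defs
begin

text \<open>
  The squared norm pushes Lebesgue measure on \<open>\<real>\<^sup>4\<close> forward to the measure \<open>\<pi>\<^sup>2 s ds\<close> on the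
  half-line, since the ball of squared radius \<open>s\<close> has volume \<open>\<pi>\<^sup>2 s\<^sup>2 / 2\<close>.  The substitution
  \<open>s = \<Lambda>\<^sup>2 x\<close> then turns both momentum integrals into \<open>J\<close> and \<open>I\<close>.  The bound on the coupling
  holds because the integrand of \<open>J\<close> is strictly below \<open>exp (- 2 x)\<close>, whose integral is \<open>1 / 2\<close>.
\<close>

text \<open>In even dimension the volume of the ball of radius \<open>sqrt a\<close> is polynomial
  in \<open>a\<close>: the even power of the radius removes the root, and the unit ball has volume
  \<pi>^n / n! with n = \<open>Suc m\<close>.\<close>

lemma emeasure_lborel_norm_square_le:
  assumes dim: "DIM('a::euclidean_space) = 2 * Suc m" and "0 \<le> a"
  shows "emeasure lborel {x::'a. (norm x)\<^sup>2 \<le> a} = ennreal (pi ^ Suc m / fact (Suc m) * a ^ Suc m)"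
proof -
  have "{x::'a. (norm x)\<^sup>2 \<le> a} = cball 0 (sqrt a)"
    using \<open>0 \<le> a\<close> by (auto simp: real_le_rsqrt sqrt_ge_absD)
  moreover have "sqrt a ^ DIM('a) = a ^ Suc m"
    using \<open>0 \<le> a\<close> by (simp only: dim power_mult real_sqrt_pow2)
  ultimately show ?thesis
    using \<open>0 \<le> a\<close> by (simp only: emeasure_cball real_sqrt_ge_zero dim unit_ball_vol_even)
qed

text \<open>This replaces polar coordinates. Both measures agree on the half-lines
  \<open>{..a}\<close>, an intersection-stable generator of the Borel sets; the density is the
  derivative in \<open>a\<close> of the ball volume.\<close>

lemma distr_lborel_norm_square:
  assumes dim: "DIM('a::euclidean_space) = 2 * Suc m"
  shows "distr (lborel :: 'a measure) borel (\<lambda>x. (norm x)\<^sup>2) =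
    density lborel (\<lambda>s. ennreal (pi ^ Suc m / fact m * s ^ m * indicator {0..} s))"
    (is "?D = ?E")
proof (rule measure_eqI_generator_eq)
  show "Int_stable (range (\<lambda>a::real. {..a}))"
    by (auto simp: Int_stable_def)
  show "range (\<lambda>a::real. {..a}) \<subseteq> Pow UNIV" by simp
  show "sets ?D = sigma_sets UNIV (range (\<lambda>a::real. {..a}))"
    "sets ?E = sigma_sets UNIV (range (\<lambda>a::real. {..a}))"
    by (simp_all add: borel_eq_atMost sets_measure_of)
  \<comment> \<open>The uniqueness rule needs an exhaustion of the line by generators of finite
    measure; finiteness is checked on the pushforward side, where it is a ball volume.\<close>
  show "range (\<lambda>n::nat. {..real n}) \<subseteq> range (\<lambda>a::real. {..a})" by auto
  show "(\<Union>n::nat. {..real n}) = UNIV"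
    using real_arch_simple by auto
  have D: "emeasure ?D {..a} = emeasure lborel {x::'a. (norm x)\<^sup>2 \<le> a}" for a
    by (subst emeasure_distr) (auto intro!: arg_cong[where f = "emeasure lborel"])
  show "emeasure ?D {..real n} \<noteq> \<infinity>" for n :: nat
    unfolding D by (subst emeasure_lborel_norm_square_le[OF dim]) auto
  show "emeasure ?D X = emeasure ?E X" if "X \<in> range (\<lambda>a::real. {..a})" for X
  proof -
    from that obtain a where X: "X = {..a}" by auto
    have E: "emeasure ?E X = (\<integral>\<^sup>+s. ennreal (pi ^ Suc m / fact m * s ^ m) * indicator {0..a} s \<partial>lborel)"
      unfolding X
      by (subst emeasure_density)
        (auto intro!: nn_integral_cong split: split_indicator simp: indicator_def)
    show ?thesis
    proof (cases "0 \<le> a")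
      case False
      then have "{x::'a. (norm x)\<^sup>2 \<le> a} = {}"
        using zero_le_power2 order_trans by blast
      then show ?thesis using False E unfolding X D by simp
    next
      case True
      \<comment> \<open>Differentiating the ball volume brings down \<open>Suc m\<close>, which
        cancels against \<open>fact (Suc m)\<close> and leaves \<open>fact m\<close>.\<close>
      have "((\<lambda>s. pi ^ Suc m / fact (Suc m) * s ^ Suc m) has_real_derivative
          pi ^ Suc m / fact m * s ^ m) (at s)" for s :: real
        by (auto intro!: derivative_eq_intros simp: field_simps simp del: power_Suc of_nat_Suc)
      then have "emeasure ?E X = ennreal (pi ^ Suc m / fact (Suc m) * a ^ Suc m - 0)"
        unfolding E
        by (subst nn_integral_FTC_Icc[where F = "\<lambda>s. pi ^ Suc m / fact (Suc m) * s ^ Suc m"])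
          (use True in \<open>auto intro: has_field_derivative_at_within\<close>)
      then show ?thesis
        unfolding X D by (subst emeasure_lborel_norm_square_le[OF dim True]) simp
    qed
  qed
qed

text \<open>Integrals pass through the pushforward and then through its density. The formula for the
  value carries no integrability assumption, because both sides are 0 by convention when
  integrability fails.\<close>

lemma
  fixes F :: "real \<Rightarrow> real"
  assumes dim: "DIM('a::euclidean_space) = 2 * Suc m"
    and [measurable]: "F \<in> borel_measurable borel"
  shows integrable_norm_square_iff:
      "integrable lborel (\<lambda>x::'a. F ((norm x)\<^sup>2)) \<longleftrightarrow>
        set_integrable lborel {0..} (\<lambda>s. s ^ m * F s)" (is ?integrable)
    and integral_norm_square:
      "(LINT x|lborel. F ((norm (x::'a))\<^sup>2)) =
        pi ^ Suc m / fact m * (LBINT s:{0..}. s ^ m * F s)" (is ?integral)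
proof -
  let ?w = "\<lambda>s::real. pi ^ Suc m / fact m * s ^ m * indicator {0..} s"
  have nn: "0 \<le> ?w s" for s
    by (auto split: split_indicator)
  have eq: "?w s *\<^sub>R F s = pi ^ Suc m / fact m * (indicator {0..} s *\<^sub>R (s ^ m * F s))" for s
    by simp
  have "integrable lborel (\<lambda>x::'a. F ((norm x)\<^sup>2)) \<longleftrightarrow>
      integrable (distr (lborel :: 'a measure) borel (\<lambda>x. (norm x)\<^sup>2)) F"
    by (subst integrable_distr_eq) auto
  also have "\<dots> \<longleftrightarrow> integrable lborel (\<lambda>s. ?w s *\<^sub>R F s)"
    unfolding distr_lborel_norm_square[OF dim] by (rule integrable_density) (use nn in auto)
  finally show ?integrable
    unfolding eq set_integrable_def by (simp only: integrable_mult_left_iff) simp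
  have "(LINT x|lborel. F ((norm (x::'a))\<^sup>2)) =
      integral\<^sup>L (distr (lborel :: 'a measure) borel (\<lambda>x. (norm x)\<^sup>2)) F"
    by (subst integral_distr) auto
  also have "\<dots> = (LINT s|lborel. ?w s *\<^sub>R F s)"
    unfolding distr_lborel_norm_square[OF dim] by (rule integral_density) (use nn in auto)
  finally show ?integral
    unfolding eq set_lebesgue_integral_def by simp
qed

text \<open>Scaling by a positive \<open>c\<close> preserves the half-line, so its indicator is
  invariant and the affine substitution on the whole line applies.\<close>

lemma
  fixes g :: "real \<Rightarrow> real"
  assumes "0 < c"
  shows set_integrable_Ici_scale:
      "set_integrable lborel {0..} (\<lambda>x. g (c * x)) \<longleftrightarrow> set_integrable lborel {0..} g"
    and set_integral_Ici_scale:
      "(LBINT x:{0..}. g x) = c * (LBINT x:{0..}. g (c * x))"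
proof -
  have ind: "indicator {0..} (c * x) = (indicator {0..} x :: real)" for x
    using \<open>0 < c\<close> by (auto simp: zero_le_mult_iff split: split_indicator)
  show "set_integrable lborel {0..} (\<lambda>x. g (c * x)) \<longleftrightarrow> set_integrable lborel {0..} g"
    using lborel_integrable_real_affine_iff[of c "\<lambda>x. indicator {0..} x *\<^sub>R g x" 0] \<open>0 < c\<close>
    by (simp add: set_integrable_def ind)
  show "(LBINT x:{0..}. g x) = c * (LBINT x:{0..}. g (c * x))"
    using lborel_integral_real_affine[of c "\<lambda>x. indicator {0..} x *\<^sub>R g x" 0] \<open>0 < c\<close>
    by (simp add: set_lebesgue_integral_def ind)
qed

text \<open>This supplies the dominating function for \<open>I\<close> and \<open>J\<close> and, at
  \<open>c = 2\<close>, the constant 1/2 that bounds \<open>J\<close>.\<close>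

lemma has_bochner_integral_exp_minus_Ici:
  assumes "0 < (c::real)"
  shows "has_bochner_integral lborel (\<lambda>x. indicator {0..} x *\<^sub>R exp (- c * x)) (1 / c)"
proof (rule has_bochner_integral_nn_integral)
  have "((\<lambda>x. exp (- (c * x))) \<longlongrightarrow> 0) at_top"
    using \<open>0 < c\<close>
    by (intro filterlim_compose[OF exp_at_bot] filterlim_compose[OF filterlim_uminus_at_bot_at_top]
        filterlim_tendsto_pos_mult_at_top[OF tendsto_const] filterlim_ident)
  then have lim: "((\<lambda>x. - exp (- (c * x)) / c) \<longlongrightarrow> 0) at_top"
    using tendsto_divide[OF tendsto_minus tendsto_const, of "\<lambda>x. exp (- (c * x))" 0 at_top c]
      \<open>0 < c\<close> by simp
  have "(\<integral>\<^sup>+x. ennreal (indicator {0..} x *\<^sub>R exp (- c * x)) \<partial>lborel) =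
      (\<integral>\<^sup>+x. ennreal (exp (- c * x)) * indicator {0..} x \<partial>lborel)"
    by (intro nn_integral_cong) (auto split: split_indicator)
  also have "\<dots> = ennreal (0 - (- exp (- (c * 0)) / c))"
    using \<open>0 < c\<close> lim
    by (intro nn_integral_FTC_atLeast) (auto intro!: derivative_eq_intros)
  finally show "(\<integral>\<^sup>+x. ennreal (indicator {0..} x *\<^sub>R exp (- c * x)) \<partial>lborel) = ennreal (1 / c)"
    by simp
qed (use assms in auto)

text \<open>Treats \<open>J\<close> (\<open>c = 2\<close>) and \<open>I\<close>
  (\<open>c = 1\<close>) together: the fraction without its exponential numerator is at most 1, so
  \<open>exp (- c * x)\<close> dominates.\<close>

lemma set_integrable_damped_fraction:
  fixes r :: real
  assumes "0 < c"
  shows "set_integrable lborel {0..} (\<lambda>x. x * exp (- c * x) / (x + r\<^sup>2 * exp (- 2 * x)))"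
  unfolding set_integrable_def
proof (rule Bochner_Integration.integrable_bound)
  show "integrable lborel (\<lambda>x. indicator {0..} x *\<^sub>R exp (- c * x))"
    using has_bochner_integral_exp_minus_Ici[OF assms] by (rule integrable.intros)
  show "AE x in lborel. norm (indicator {0..} x *\<^sub>R
      (x * exp (- c * x) / (x + r\<^sup>2 * exp (- 2 * x)))) \<le> norm (indicator {0..} x *\<^sub>R exp (- c * x))"
  proof (rule AE_I2)
    fix x :: real
    \<comment> \<open>The point \<open>x = 0\<close> is separate because the denominator vanishes
      there when \<open>r = 0\<close>; the quotient is 0 in any case.\<close>
    have "x / (x + r\<^sup>2 * exp (- 2 * x)) \<le> 1" if "0 \<le> x"
      using that by (cases "x = 0") (simp_all add: add_pos_nonneg)
    then have "x / (x + r\<^sup>2 * exp (- 2 * x)) * exp (- c * x) \<le> exp (- c * x)" if "0 \<le> x"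
      using mult_right_mono[of _ 1 "exp (- c * x)"] that by fastforce
    then show "norm (indicator {0..} x *\<^sub>R
      (x * exp (- c * x) / (x + r\<^sup>2 * exp (- 2 * x)))) \<le> norm (indicator {0..} x *\<^sub>R exp (- c * x))"
      by (auto simp: indicator_def)
  qed
qed measurable

lemma set_integrable_J: "set_integrable lborel {0..} (J_integrand r)"
  using set_integrable_damped_fraction[of 2 r] by (simp add: J_integrand_def[abs_def])

lemma set_integrable_I: "set_integrable lborel {0..} (I_integrand r)"
  using set_integrable_damped_fraction[of 1 r] by (simp add: I_integrand_def[abs_def])

lemma J_less_half:
  assumes "0 < r"
  shows "J r < 1 / 2"
proof -
  define d where "d x = indicator {0..} x *\<^sub>R exp (- 2 * x) - indicator {0..} x *\<^sub>R J_integrand r x"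
    for x :: real
  have E: "integrable lborel (\<lambda>x::real. indicator {0..} x *\<^sub>R exp (- 2 * x))"
    "(LINT x|lborel. indicator {0..} x *\<^sub>R exp (- 2 * x)) = (1 / 2 :: real)"
    using has_bochner_integral_exp_minus_Ici[of 2] by (simp_all add: has_bochner_integral_iff)
  have int: "integrable lborel d"
    unfolding d_def[abs_def]
    by (intro Bochner_Integration.integrable_diff E(1) set_integrable_J[unfolded set_integrable_def])
  have eq: "(LINT x|lborel. d x) = 1 / 2 - J r"
    unfolding d_def[abs_def] J_def set_lebesgue_integral_def
    by (subst Bochner_Integration.integral_diff)
      (simp_all only: E set_integrable_J[unfolded set_integrable_def])
  have pos: "0 < d x" if "0 \<le> x" for x
  proof -
    have "x / (x + r\<^sup>2 * exp (- 2 * x)) < 1"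
      using that \<open>0 < r\<close> by (simp add: divide_less_eq_1 add_nonneg_pos)
    then have "x / (x + r\<^sup>2 * exp (- 2 * x)) * exp (- 2 * x) < exp (- 2 * x)"
      using mult_strict_right_mono[of _ 1 "exp (- 2 * x)"] by fastforce
    then show ?thesis using that by (simp add: d_def J_integrand_def)
  qed
  have nn: "0 \<le> d x" for x
    using pos[of x] by (cases "0 \<le> x") (auto simp: d_def)
  \<comment> \<open>Pointwise strictness survives integration: a nonnegative \<open>d\<close> with
    zero integral would vanish almost everywhere, yet it is positive on \<open>{0..1}\<close>, which
    has measure 1.\<close>
  have "(LINT x|lborel. d x) \<noteq> 0"
  proof
    assume "(LINT x|lborel. d x) = 0"
    then have "AE x in lborel. d x = 0"
      using integral_nonneg_eq_0_iff_AE[OF int] nn by auto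
    then have "AE x in lborel. x \<notin> {0..1::real}"
      by eventually_elim (use pos in force)
    then have "emeasure lborel {0..1::real} = 0"
      by (subst (asm) AE_iff_null_sets[symmetric]) (auto dest: null_setsD1)
    then show False by simp
  qed
  moreover have "0 \<le> (LINT x|lborel. d x)"
    using nn by simp
  ultimately show ?thesis using eq by simp
qed

lemma
  fixes \<Lambda> M0 r :: real
  assumes "0 < \<Lambda>" and r_def: "r = M0 / \<Lambda>"
  shows integrable_gap_integrand: "integrable lborel (gap_integrand M0 \<Lambda>)"
    and integral_gap_integrand:
      "(LINT k|lborel. gap_integrand M0 \<Lambda> k) = \<Lambda>\<^sup>2 / (16 * pi\<^sup>2) * J r"
    and integrable_condensate_integrand: "integrable lborel (condensate_integrand M0 \<Lambda>)"
    and integral_condensate_integrand: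
      "(LINT p|lborel. condensate_integrand M0 \<Lambda> p) = r * \<Lambda> ^ 3 / (16 * pi\<^sup>2) * I r"
proof -
  \<comment> \<open>With \<open>m = 1\<close> the radial density is \<pi>^2 s; the power
    \<open>^ 1\<close> is kept below to match the general lemmas.\<close>
  have dim: "DIM(real ^ 4) = 2 * Suc 1" by simp
  have pos: "0 < \<Lambda>\<^sup>2" using \<open>0 < \<Lambda>\<close> by simp
  have M0: "M0 = r * \<Lambda>" using assms by simp
  define g where "g s = (form_factor \<Lambda> s)\<^sup>2 / (s + M0\<^sup>2 * (form_factor \<Lambda> s)\<^sup>2)" for s
  define h where "h s = dynamical_mass M0 \<Lambda> s / (s + (dynamical_mass M0 \<Lambda> s)\<^sup>2)" for s
  have [measurable]: "g \<in> borel_measurable borel" "h \<in> borel_measurable borel"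
    unfolding g_def[abs_def] h_def[abs_def] dynamical_mass_def form_factor_def by measurable
  have f: "form_factor \<Lambda> (\<Lambda>\<^sup>2 * x) = exp (- x)" for x
    using pos by (simp add: form_factor_def)
  have e: "exp (- x) * exp (- x) = exp (- 2 * x)" for x :: real
    by (simp flip: exp_add)
  have den: "\<Lambda>\<^sup>2 * x + (r * \<Lambda>)\<^sup>2 * exp (- 2 * x) = \<Lambda>\<^sup>2 * (x + r\<^sup>2 * exp (- 2 * x))" for x
    by (simp add: power2_eq_square algebra_simps)
  \<comment> \<open>At s = \<Lambda>^2 x the factor \<Lambda>^2 of the radial weight cancels the one
    that \<open>den\<close> extracts from the denominator.\<close>
  have g: "(\<Lambda>\<^sup>2 * x) ^ 1 * g (\<Lambda>\<^sup>2 * x) = J_integrand r x" for x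
    using pos by (simp add: g_def f J_integrand_def M0 power2_eq_square[of "exp _"] e
        den[simplified])
  \<comment> \<open>The same cancellation, but the numerator is a single mass: it leaves M0 = r
    \<Lambda> in front and only one form factor, hence \<open>exp (- x)\<close>.\<close>
  have h: "(\<Lambda>\<^sup>2 * x) ^ 1 * h (\<Lambda>\<^sup>2 * x) = (r * \<Lambda>) * I_integrand r x" for x
    using pos by (simp add: h_def f I_integrand_def M0 dynamical_mass_def power_mult_distrib[of _ "exp _"]
        power2_eq_square[of "exp _"] e den[simplified])
  have gap: "gap_integrand M0 \<Lambda> = (\<lambda>k. 1 / (2 * pi) ^ 4 * g ((norm k)\<^sup>2))"
    by (simp add: gap_integrand_def g_def fun_eq_iff)
  have cond: "condensate_integrand M0 \<Lambda> = (\<lambda>k. 1 / (2 * pi) ^ 4 * h ((norm k)\<^sup>2))"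
    by (simp add: condensate_integrand_def h_def fun_eq_iff)
  have "set_integrable lborel {0..} (\<lambda>s. s ^ 1 * g s)"
    by (subst set_integrable_Ici_scale[OF pos, symmetric])
      (simp only: g set_integrable_J)
  then show "integrable lborel (gap_integrand M0 \<Lambda>)"
    unfolding gap by (intro integrable_mult_right) (subst integrable_norm_square_iff[OF dim], auto)
  have "set_integrable lborel {0..} (\<lambda>s. s ^ 1 * h s)"
    by (subst set_integrable_Ici_scale[OF pos, symmetric])
      (simp only: h set_integrable_I set_integrable_mult_right)
  then show "integrable lborel (condensate_integrand M0 \<Lambda>)"
    unfolding cond by (intro integrable_mult_right) (subst integrable_norm_square_iff[OF dim], auto)
  \<comment> \<open>Here \<Lambda>^2 is the Jacobian of the substitution. Together with the angular
    factor, \<pi>^2 / (2 \<pi>)^4 gives 1 / (16 \<pi>^2).\<close>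
  have "(LBINT s:{0..}. s ^ 1 * g s) = \<Lambda>\<^sup>2 * J r"
    by (subst set_integral_Ici_scale[OF pos]) (simp only: g J_def)
  then have "(LINT k|lborel. g ((norm (k :: real ^ 4))\<^sup>2)) = pi\<^sup>2 * (\<Lambda>\<^sup>2 * J r)"
    by (subst integral_norm_square[OF dim]) (auto simp: power2_eq_square)
  then show "(LINT k|lborel. gap_integrand M0 \<Lambda> k) = \<Lambda>\<^sup>2 / (16 * pi\<^sup>2) * J r"
    unfolding gap by (simp add: field_simps power4_eq_xxxx power2_eq_square)
  have "(LBINT s:{0..}. s ^ 1 * h s) = \<Lambda>\<^sup>2 * ((r * \<Lambda>) * I r)"
    by (subst set_integral_Ici_scale[OF pos]) (simp only: h I_def set_integral_mult_right)
  then have "(LINT k|lborel. h ((norm (k :: real ^ 4))\<^sup>2)) = pi\<^sup>2 * (\<Lambda>\<^sup>2 * ((r * \<Lambda>) * I r))"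
    by (subst integral_norm_square[OF dim]) (auto simp: power2_eq_square)
  then show "(LINT p|lborel. condensate_integrand M0 \<Lambda> p) = r * \<Lambda> ^ 3 / (16 * pi\<^sup>2) * I r"
    unfolding cond by (simp add: field_simps power4_eq_xxxx power2_eq_square power3_eq_cube)
qed

theorem proposition2:
  fixes Nc Nf :: nat and G \<Lambda> M0 r \<alpha> :: real
  assumes "Nc > 0" and "Nf > 0" and "G > 0" and "\<Lambda> > 0" and "M0 > 0"
    and r_def: "r = M0 / \<Lambda>"
    and \<alpha>_def: "\<alpha> = chiral_coupling Nc Nf G \<Lambda>"
  shows "(integrable lborel (gap_integrand M0 \<Lambda>)) \<and>
    (set_integrable lborel {0..} (J_integrand r)) \<and>
    (gap_rhs Nc Nf G M0 \<Lambda> = \<alpha> * J r) \<and>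
    (gap_equation Nc Nf G M0 \<Lambda> \<longleftrightarrow> 1 = \<alpha> * J r) \<and>
    (integrable lborel (condensate_integrand M0 \<Lambda>)) \<and>
    (set_integrable lborel {0..} (I_integrand r)) \<and>
    (condensate Nc M0 \<Lambda> = real Nc * r * \<Lambda> ^ 3 / (4 * pi\<^sup>2) * I r) \<and>
    ((\<exists>\<rho>>0. 1 = \<alpha> * J \<rho>) \<longrightarrow> \<alpha> > 2)"
proof -
  have "0 < \<alpha>"
    unfolding \<alpha>_def chiral_coupling_def using assms(1-4) by simp
  have gap: "gap_rhs Nc Nf G M0 \<Lambda> = \<alpha> * J r"
    by (simp add: gap_rhs_def integral_gap_integrand[OF \<open>0 < \<Lambda>\<close> r_def] \<alpha>_def chiral_coupling_def
        field_simps)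
  have "condensate Nc M0 \<Lambda> = real Nc * r * \<Lambda> ^ 3 / (4 * pi\<^sup>2) * I r"
    by (simp add: condensate_def integral_condensate_integrand[OF \<open>0 < \<Lambda>\<close> r_def] field_simps)
  \<comment> \<open>Multiplying \<open>J \<rho> < 1 / 2\<close> by the positive coupling turns the
    gap equation into 1 < \<alpha> / 2, for any \<rho> > 0 and not just for
    \<open>r\<close>.\<close>
  moreover have "\<alpha> > 2" if "\<rho> > 0" "1 = \<alpha> * J \<rho>" for \<rho>
    using mult_strict_left_mono[OF J_less_half[OF \<open>\<rho> > 0\<close>] \<open>0 < \<alpha>\<close>] that(2) by simp
  ultimately show ?thesis
    using gap integrable_gap_integrand[OF \<open>0 < \<Lambda>\<close> r_def]
      integrable_condensate_integrand[OF \<open>0 < \<Lambda>\<close> r_def] set_integrable_J set_integrable_I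
    by (auto simp: gap_equation_def)
qed

end
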